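(* Let $k$ be a field, let $\bar c\in k$ be a square (in $k$), and let $\bar d\in k$ be an element that is not a nonzero square, i.e. $\bar d\notin k^{\times 2}$. Then $$C=\{(x,y)\in k^2 \mid x^2+\bar c\,y^2-1-\bar d\,x^2y^2=0\}$$ is an abelian group with binary operation $$(x_1,y_1)\oplus(x_2,y_2)=\left(\frac{x_1x_2-\bar c\,y_1y_2}{1-\bar d\,x_1x_2y_1y_2},\ \frac{x_1y_2+y_1x_2}{1+\bar d\,x_1x_2y_1y_2}\right).$$
   Context: $k^{\times 2}=\{a^2\mid a\in k,\ a\neq 0\}$ denotes the set of nonzero squares of $k$; in particular $\bar d=0$ is allowed, and $\bar c=0$ is allowed as a square. The field $k$ is arbitrary (any characteristic). That $C$ is a group under $\oplus$ is understood to include that $\oplus$ is a well-defined operation $C\times C\to C$ (the denominators do not vanish on $C\times C$). *)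

theory Defs
  imports "HOL-Algebra.Group"
begin

definition nonzero_squares :: "'a::field set" where
  "nonzero_squares = {a\<^sup>2 | a. a \<noteq> 0}"

definition edwards_curve :: "'a::field \<Rightarrow> 'a \<Rightarrow> ('a \<times> 'a) set" where
  "edwards_curve c d = {(x, y). x\<^sup>2 + c * y\<^sup>2 - 1 - d * x\<^sup>2 * y\<^sup>2 = 0}"

definition edwards_denom_minus :: "'a::field \<Rightarrow> 'a \<times> 'a \<Rightarrow> 'a \<times> 'a \<Rightarrow> 'a" where
  "edwards_denom_minus d = (\<lambda>(x1, y1) (x2, y2). 1 - d * x1 * x2 * y1 * y2)"

definition edwards_denom_plus :: "'a::field \<Rightarrow> 'a \<times> 'a \<Rightarrow> 'a \<times> 'a \<Rightarrow> 'a" where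
  "edwards_denom_plus d = (\<lambda>(x1, y1) (x2, y2). 1 + d * x1 * x2 * y1 * y2)"

text \<open>
  Division is total in HOL (a quotient by zero is zero), so this is the intended partial operation
  only where both denominators are nonzero. That they are nonzero on the curve therefore has to be
  claimed separately from the group axioms.
\<close>

definition edwards_add :: "'a::field \<Rightarrow> 'a \<Rightarrow> 'a \<times> 'a \<Rightarrow> 'a \<times> 'a \<Rightarrow> 'a \<times> 'a" where
  "edwards_add c d p q = (case (p, q) of ((x1, y1), (x2, y2)) \<Rightarrow>
     ((x1 * x2 - c * y1 * y2) / edwards_denom_minus d p q,
      (x1 * y2 + y1 * x2) / edwards_denom_plus d p q))"

end

theory Submission
  imports Defs
begin

text \<open>
  Put \<open>\<delta> = d x\<^sub>1 x\<^sub>2 y\<^sub>1 y\<^sub>2\<close> and \<open>c = a\<^sup>2\<close>. If \<open>\<delta>\<^sup>2 = 1\<close>, the two curve equations give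
  \<open>d (x\<^sub>1 y\<^sub>1 (x\<^sub>2 \<plusminus> a y\<^sub>2))\<^sup>2 = (x\<^sub>1 \<plusminus> \<delta> a y\<^sub>1)\<^sup>2\<close>, so \<open>d\<close> is a nonzero square unless
  \<open>x\<^sub>2 + a y\<^sub>2 = x\<^sub>2 - a y\<^sub>2 = 0\<close>. The latter forces \<open>2 x\<^sub>2 = 0\<close>, so the characteristic is 2, and then
  the curve equation reads \<open>d (x\<^sub>2 y\<^sub>2)\<^sup>2 = 1\<close>. Hence no denominator vanishes, and closure and
  associativity become membership of a polynomial in the ideal of the curve equations.
  By commutativity, associativity is the symmetry of \<open>(p \<oplus> q) \<oplus> r\<close> under exchanging \<open>p\<close> and \<open>r\<close>,
  so a single formula for the iterated sum suffices.
\<close>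

lemma edwards_curve_iff:
  "(x, y) \<in> edwards_curve c d \<longleftrightarrow> x^2 + c * y^2 = 1 + d * x^2 * y^2"
  by (simp add: edwards_curve_def) (auto simp: algebra_simps)

lemma edwards_add_Pair:
  "edwards_add c d (x1, y1) (x2, y2) =
     ((x1 * x2 - c * y1 * y2) / (1 - d * x1 * x2 * y1 * y2),
      (x1 * y2 + y1 * x2) / (1 + d * x1 * x2 * y1 * y2))"
  by (simp add: edwards_add_def edwards_denom_minus_def edwards_denom_plus_def)

lemma edwards_add_commute: "edwards_add c d p q = edwards_add c d q p"
  by (cases p; cases q) (simp add: edwards_add_Pair algebra_simps)

lemma nonzero_squaresI:
  assumes "d * u^2 = v^2" "u \<noteq> 0" "v \<noteq> 0"
  shows "d \<in> nonzero_squares"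
proof -
  have "d = (v / u)^2"
    using assms by (simp add: power_divide eq_divide_eq)
  then show ?thesis
    unfolding nonzero_squares_def using assms by (intro CollectI exI[of _ "v / u"]) auto
qed

lemma edwards_denom_square_neq_1:
  fixes c d :: "'a::field"
  assumes c: "c = a^2" and d: "d \<notin> nonzero_squares"
    and "(x1, y1) \<in> edwards_curve c d" "(x2, y2) \<in> edwards_curve c d"
  shows "(d * x1 * x2 * y1 * y2)^2 \<noteq> 1"
proof
  define e where "e = d * x1 * x2 * y1 * y2"
  assume "(d * x1 * x2 * y1 * y2)^2 = 1"
  then have e2: "e^2 = 1" by (simp add: e_def)
  then have "e \<noteq> 0" by auto
  then have nz: "d \<noteq> 0" "x1 \<noteq> 0" "x2 \<noteq> 0" "y1 \<noteq> 0" "y2 \<noteq> 0" by (auto simp: e_def)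
  have 1: "x1^2 + a^2 * y1^2 = 1 + d * x1^2 * y1^2"
    and 2: "x2^2 + a^2 * y2^2 = 1 + d * x2^2 * y2^2"
    using assms by (simp_all add: edwards_curve_iff)
  \<comment> \<open>Here \<open>b\<close> covers both signs \<open>a\<close> and \<open>- a\<close>,
    as only \<open>b^2 = a^2\<close> enters.\<close>
  have "x2 + b * y2 = 0" if b: "b^2 = a^2" for b
  proof (rule ccontr)
    assume "x2 + b * y2 \<noteq> 0"
    then have u: "x1 * y1 * (x2 + b * y2) \<noteq> 0" using nz by simp
    \<comment> \<open>Expanding the left side and using the second curve equation gives
      \<open>d * x1^2 * y1^2 + e^2 + 2 * b * e * x1 * y1\<close>. With \<open>e^2 = 1\<close> the
      first curve equation completes the square.\<close>
    have "d * (x1 * y1 * (x2 + b * y2))^2 = (x1 + e * b * y1)^2"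
      using 1 2 b e2 e_def by algebra
    moreover from this have "x1 + e * b * y1 \<noteq> 0"
      using u nz by (metis mult_eq_0_iff power_not_zero zero_power2)
    ultimately show False using nonzero_squaresI u d by blast
  qed
  from this[of a] this[of "- a"] have pm: "x2 + a * y2 = 0" "x2 - a * y2 = 0" by auto
  then have "(1 + 1) * x2 = 0" by algebra
  then have two: "(1 + 1 :: 'a) = 0" using nz by (metis mult_eq_0_iff)
  have "1 + d * (x2 * y2)^2 = (1 + 1) * x2^2" using 2 pm by algebra
  \<comment> \<open>In characteristic 2 the right side above is 0, which is also
    \<open>1 + 1\<close>; cancel one 1.\<close>
  then have "d * (x2 * y2)^2 = 1^2"
    using two by (metis add_left_cancel mult_zero_left one_power2)
  then show False using nonzero_squaresI[of d "x2 * y2" 1] nz d by simp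
qed

lemma edwards_denoms_nonzero:
  fixes c d :: "'a::field"
  assumes "c = a^2" "d \<notin> nonzero_squares"
    and "(x1, y1) \<in> edwards_curve c d" "(x2, y2) \<in> edwards_curve c d"
  shows "1 - d * x1 * x2 * y1 * y2 \<noteq> 0" "1 + d * x1 * x2 * y1 * y2 \<noteq> 0"
  using edwards_denom_square_neq_1[OF assms]
  by (auto simp: power2_eq_1_iff add_eq_0_iff)

text \<open>This is the curve equation of the sum, multiplied by the square of both denominators so
  that it becomes a polynomial identity.\<close>

lemma edwards_add_closed_poly:
  fixes c d x1 y1 x2 y2 :: "'a::idom"
  assumes "x1^2 + c * y1^2 = 1 + d * x1^2 * y1^2" "x2^2 + c * y2^2 = 1 + d * x2^2 * y2^2"
  defines "e \<equiv> d * x1 * x2 * y1 * y2"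
  shows "((x1 * x2 - c * y1 * y2) * (1 + e))^2 + c * ((x1 * y2 + y1 * x2) * (1 - e))^2
    = ((1 - e) * (1 + e))^2 + d * (x1 * x2 - c * y1 * y2)^2 * (x1 * y2 + y1 * x2)^2"
  using assms by algebra

lemma edwards_add_closed:
  fixes c d :: "'a::field"
  assumes "c = a^2" "d \<notin> nonzero_squares" and p: "p \<in> edwards_curve c d" and q: "q \<in> edwards_curve c d"
  shows "edwards_add c d p q \<in> edwards_curve c d"
proof -
  obtain x1 y1 x2 y2 where pq: "p = (x1, y1)" "q = (x2, y2)" by (cases p; cases q)
  define u v n m where "u = 1 - d * x1 * x2 * y1 * y2" and "v = 1 + d * x1 * x2 * y1 * y2"
    and "n = x1 * x2 - c * y1 * y2" and "m = x1 * y2 + y1 * x2"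
  note defs = this
  have uv: "u \<noteq> 0" "v \<noteq> 0"
    using edwards_denoms_nonzero[OF assms(1,2) p[unfolded pq] q[unfolded pq]] by (simp_all add: defs)
  have "(n * v)^2 + c * (m * u)^2 = (u * v)^2 + d * n^2 * m^2"
    using edwards_add_closed_poly[of x1 c y1 d x2 y2] p q by (simp add: pq edwards_curve_iff defs)
  then have "(n / u)^2 + c * (m / v)^2 = 1 + d * (n / u)^2 * (m / v)^2"
    using uv by (simp add: power_divide power_mult_distrib field_simps)
  then show ?thesis
    by (simp add: pq edwards_add_Pair edwards_curve_iff defs)
qed

text \<open>Each coordinate of the iterated sum is expanded by \<open>(1 - e) * (1 + e)\<close>,
  which clears the inner fractions.\<close>

lemma edwards_add_add:
  fixes c d x1 y1 x2 y2 x3 y3 :: "'a::field"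
  defines "e \<equiv> d * x1 * x2 * y1 * y2"
    and "n \<equiv> x1 * x2 - c * y1 * y2" and "m \<equiv> x1 * y2 + y1 * x2"
  assumes "1 - e \<noteq> 0" "1 + e \<noteq> 0"
  shows "edwards_add c d (edwards_add c d (x1, y1) (x2, y2)) (x3, y3) =
    ((n * (1 + e) * x3 - c * m * (1 - e) * y3) / ((1 - e) * (1 + e) - d * n * m * x3 * y3),
     (n * (1 + e) * y3 + m * (1 - e) * x3) / ((1 - e) * (1 + e) + d * n * m * x3 * y3))"
proof -
  define u v where "u = 1 - e" and "v = 1 + e"
  have uv: "u \<noteq> 0" "v \<noteq> 0" using assms by (simp_all add: u_def v_def)
  \<comment> \<open>If \<open>t = 0\<close>, both sides are 0 by convention, so the outer
    denominators may vanish here.\<close>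
  have *: "s / t = (s * (u * v)) / (t * (u * v))" for s t
    using uv by simp
  have "(n / u * x3 - c * (m / v) * y3) / (1 - d * (n / u) * x3 * (m / v) * y3)
      = (n * v * x3 - c * m * u * y3) / (u * v - d * n * m * x3 * y3)"
    by (subst *, rule arg_cong2[of _ _ _ _ "(/)"]) (use uv in \<open>simp_all add: field_simps\<close>)
  moreover have "(n / u * y3 + m / v * x3) / (1 + d * (n / u) * x3 * (m / v) * y3)
      = (n * v * y3 + m * u * x3) / (u * v + d * n * m * x3 * y3)"
    by (subst *, rule arg_cong2[of _ _ _ _ "(/)"]) (use uv in \<open>simp_all add: field_simps\<close>)
  ultimately show ?thesis
    by (simp add: edwards_add_Pair u_def v_def e_def n_def m_def)
qed

text \<open>These are the denominators for adding the third point to the sum of the first two, times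
  \<open>(1 - e) * (1 + e)\<close>. The sum lies on the curve by closure, so the result on
  denominators applies a second time.\<close>

lemma edwards_add_add_denoms:
  fixes c d :: "'a::field"
  assumes c: "c = a^2" and d: "d \<notin> nonzero_squares"
    and p: "(x1, y1) \<in> edwards_curve c d" and q: "(x2, y2) \<in> edwards_curve c d"
    and r: "(x3, y3) \<in> edwards_curve c d"
  defines "e \<equiv> d * x1 * x2 * y1 * y2"
    and "n \<equiv> x1 * x2 - c * y1 * y2" and "m \<equiv> x1 * y2 + y1 * x2"
  shows "(1 - e) * (1 + e) - d * n * m * x3 * y3 \<noteq> 0"
    and "(1 - e) * (1 + e) + d * n * m * x3 * y3 \<noteq> 0"
proof -
  have uv: "1 - e \<noteq> 0" "1 + e \<noteq> 0"
    using edwards_denoms_nonzero[OF c d p q] by (simp_all add: e_def)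
  have "(n / (1 - e), m / (1 + e)) \<in> edwards_curve c d"
    using edwards_add_closed[OF c d p q] by (simp add: edwards_add_Pair e_def n_def m_def)
  note D = edwards_denoms_nonzero[OF c d this r]
  have "(1 - e) * (1 + e) - d * n * m * x3 * y3 =
      (1 - e) * (1 + e) * (1 - d * (n / (1 - e)) * x3 * (m / (1 + e)) * y3)"
    using uv by (simp add: right_diff_distrib[of "_ * _"])
  then show "(1 - e) * (1 + e) - d * n * m * x3 * y3 \<noteq> 0"
    using uv D by simp
  have "(1 - e) * (1 + e) + d * n * m * x3 * y3 =
      (1 - e) * (1 + e) * (1 + d * (n / (1 - e)) * x3 * (m / (1 + e)) * y3)"
    using uv by (simp add: distrib_left[of "_ * _"])
  then show "(1 - e) * (1 + e) + d * n * m * x3 * y3 \<noteq> 0"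
    using uv D by simp
qed

text \<open>Primed quantities arise by exchanging the indices 1 and 3. The equations are the
  cross-multiplied coordinates of the two iterated sums.\<close>

lemma edwards_add_assoc_poly:
  fixes c d x1 y1 x2 y2 x3 y3 :: "'a::idom"
  assumes "x1^2 + c * y1^2 = 1 + d * x1^2 * y1^2" "x2^2 + c * y2^2 = 1 + d * x2^2 * y2^2"
    "x3^2 + c * y3^2 = 1 + d * x3^2 * y3^2"
  defines "e \<equiv> d * x1 * x2 * y1 * y2" and "n \<equiv> x1 * x2 - c * y1 * y2" and "m \<equiv> x1 * y2 + y1 * x2"
    and "e' \<equiv> d * x3 * x2 * y3 * y2" and "n' \<equiv> x3 * x2 - c * y3 * y2" and "m' \<equiv> x3 * y2 + y3 * x2"
  shows "(n * (1 + e) * x3 - c * m * (1 - e) * y3) * ((1 - e') * (1 + e') - d * n' * m' * x1 * y1) =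
      (n' * (1 + e') * x1 - c * m' * (1 - e') * y1) * ((1 - e) * (1 + e) - d * n * m * x3 * y3)"
    and "(n * (1 + e) * y3 + m * (1 - e) * x3) * ((1 - e') * (1 + e') + d * n' * m' * x1 * y1) =
      (n' * (1 + e') * y1 + m' * (1 - e') * x1) * ((1 - e) * (1 + e) + d * n * m * x3 * y3)"
  unfolding e_def n_def m_def e'_def n'_def m'_def using assms(1-3) by algebra+

lemma edwards_add_rotate:
  fixes c d :: "'a::field"
  assumes c: "c = a^2" and d: "d \<notin> nonzero_squares"
    and "p \<in> edwards_curve c d" "q \<in> edwards_curve c d" "r \<in> edwards_curve c d"
  shows "edwards_add c d (edwards_add c d p q) r = edwards_add c d (edwards_add c d r q) p"
proof -
  obtain x1 y1 x2 y2 x3 y3 where pqr: "p = (x1, y1)" "q = (x2, y2)" "r = (x3, y3)"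
    by (cases p; cases q; cases r)
  have p: "(x1, y1) \<in> edwards_curve c d" and q: "(x2, y2) \<in> edwards_curve c d"
    and r: "(x3, y3) \<in> edwards_curve c d"
    using assms pqr by simp_all
  show ?thesis
    unfolding pqr edwards_add_add[OF edwards_denoms_nonzero[OF c d p q]]
      edwards_add_add[OF edwards_denoms_nonzero[OF c d r q]] prod.inject
      frac_eq_eq[OF edwards_add_add_denoms(1)[OF c d p q r] edwards_add_add_denoms(1)[OF c d r q p]]
      frac_eq_eq[OF edwards_add_add_denoms(2)[OF c d p q r] edwards_add_add_denoms(2)[OF c d r q p]]
    using edwards_add_assoc_poly p q r unfolding edwards_curve_iff by blast
qed

lemma edwards_comm_group:
  fixes c d :: "'a::field"
  assumes c: "c = a^2" and d: "d \<notin> nonzero_squares"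
  shows "comm_group \<lparr>carrier = edwards_curve c d, mult = edwards_add c d, one = (1, 0)\<rparr>"
    (is "comm_group ?G")
proof (rule comm_groupI)
  fix p q r assume "p \<in> carrier ?G" "q \<in> carrier ?G" "r \<in> carrier ?G"
  then have "edwards_add c d (edwards_add c d p q) r = edwards_add c d p (edwards_add c d q r)"
    using edwards_add_rotate[OF c d, of p q r]
    by (simp add: edwards_add_commute[of c d r q] edwards_add_commute[of c d _ p])
  then show "p \<otimes>\<^bsub>?G\<^esub> q \<otimes>\<^bsub>?G\<^esub> r = p \<otimes>\<^bsub>?G\<^esub> (q \<otimes>\<^bsub>?G\<^esub> r)" by simp
next
  fix p assume p: "p \<in> carrier ?G"
  obtain x y where xy: "p = (x, y)" by (cases p)
  have 1: "(x, y) \<in> edwards_curve c d" and 2: "(x, - y) \<in> edwards_curve c d"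
    using p by (simp_all add: xy edwards_curve_iff)
  \<comment> \<open>The first coordinate is \<open>(x^2 + c * y^2) / (1 + d * x^2 * y^2)\<close>,
    where the curve equation equates numerator and denominator.\<close>
  have "edwards_add c d (x, - y) (x, y) = (1, 0)"
    using edwards_denoms_nonzero(1)[OF c d 2 1] 1
    by (simp add: edwards_add_Pair edwards_curve_iff power2_eq_square algebra_simps)
  then show "\<exists>q\<in>carrier ?G. q \<otimes>\<^bsub>?G\<^esub> p = \<one>\<^bsub>?G\<^esub>"
    using 2 by (intro bexI[of _ "(x, - y)"]) (simp_all add: xy)
qed (auto simp: edwards_add_closed[OF c d] edwards_curve_iff edwards_add_Pair
      intro: edwards_add_commute)

theorem theorem3p4p2:
  fixes c d :: "'a::field"
  assumes "\<exists>a. c = a\<^sup>2"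
    and "d \<notin> nonzero_squares"
  shows "(\<forall>p\<in>edwards_curve c d. \<forall>q\<in>edwards_curve c d.
            edwards_denom_minus d p q \<noteq> 0 \<and> edwards_denom_plus d p q \<noteq> 0) \<and>
         (\<exists>e. comm_group \<lparr>carrier = edwards_curve c d, mult = edwards_add c d, one = e\<rparr>)"
proof -
  obtain a where c: "c = a^2" using assms by blast
  have "edwards_denom_minus d p q \<noteq> 0 \<and> edwards_denom_plus d p q \<noteq> 0"
    if "p \<in> edwards_curve c d" "q \<in> edwards_curve c d" for p q
    using that edwards_denoms_nonzero[OF c assms(2)]
    by (cases p; cases q) (simp add: edwards_denom_minus_def edwards_denom_plus_def)
  with edwards_comm_group[OF c assms(2)] show ?thesis by blast
qed

end
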